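(* The mapping $\mathcal{A}:\mathbb{R}^{n\times p}\to\mathbb{R}^{n\times p}$, $\mathcal{A}(X)=\frac18X\left(15I_p-10X^\top X+3(X^\top X)^2\right)$, is a homeomorphism from $\mathbb{R}^{n\times p}$ to $\mathbb{R}^{n\times p}$. Moreover, for any $X\in\mathbb{R}^{n\times p}$ and any $\varepsilon>0$, there exists $\delta>0$ such that $\mathcal{B}(\mathcal{A}(X),\delta)\subset\mathcal{A}(\mathcal{B}(X,\varepsilon))$.
   Context: $\mathcal{B}(X,\delta)=\{Y\in\mathbb{R}^{n\times p}:\|Y-X\|_{\mathrm F}\le\delta\}$, where $\|\cdot\|_{\mathrm F}$ is the Frobenius norm. *)

theory Defs
  imports "HOL-Analysis.Analysis"
begin

text \<open>An $n \times p$ real matrix is an element of \<^typ>\<open>real ^ 'p ^ 'n\<close> (rows indexed by \<open>'n\<close>,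
  columns by \<open>'p\<close>). The square of $X^\top X$ is written with \<open>**\<close>, since \<open>^\<close> on vectors is the
  componentwise power.\<close>

definition \<A> :: "real ^ 'p ^ 'n \<Rightarrow> real ^ 'p ^ 'n" where
  "\<A> X = (1 / 8) *\<^sub>R (X ** (15 *\<^sub>R mat 1 - 10 *\<^sub>R (transpose X ** X)
            + 3 *\<^sub>R ((transpose X ** X) ** (transpose X ** X))))"

definition frobenius_norm :: "real ^ 'p ^ 'n \<Rightarrow> real" where
  "frobenius_norm X = sqrt (\<Sum>i\<in>UNIV. \<Sum>j\<in>UNIV. (X $ i $ j)\<^sup>2)"

definition \<B> :: "real ^ 'p ^ 'n \<Rightarrow> real \<Rightarrow> (real ^ 'p ^ 'n) set" where
  "\<B> X \<delta> = {Y. frobenius_norm (Y - X) \<le> \<delta>}"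

lemma frobenius_norm_eq_norm: "frobenius_norm X = norm X"
  by (simp add: frobenius_norm_def norm_vec_def L2_set_def sum_nonneg)

lemma \<B>_eq_cball: "\<B> X \<delta> = cball X \<delta>"
  by (auto simp: \<B>_def frobenius_norm_eq_norm dist_norm norm_minus_commute)

end

theory Submission
  imports Defs
begin

text \<open>
  Let \<open>p(s) = 15 s - 10 s\<^sup>3 + 3 s\<^sup>5\<close>. With \<open>S\<close> the symmetric block matrix having off-diagonal blocks
  \<open>X\<close> and \<open>X\<^sup>T\<close>, the off-diagonal blocks of \<open>p(S)\<close> are \<open>8 \<A>(X)\<close> and its transpose. Left
  multiplication \<open>L\<close> by \<open>S\<close> and right multiplication \<open>R\<close> by the matrix \<open>T\<close> belonging to \<open>Y\<close> are
  commuting self-adjoint operators for the Frobenius inner product, and \<open>p(L) - p(R)\<close> is \<open>L - R\<close>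
  times a sum of squares of polynomials in \<open>L\<close> and \<open>R\<close>, one of which is a multiple of
  \<open>(L - R)\<^sup>4\<close>. Applied to the identity matrix this shows that \<open>\<A>\<close> is injective, so it is open by
  invariance of domain. The bound \<open>\<parallel>\<A>(X)\<parallel> \<ge> 5/6 \<parallel>X\<parallel>\<close> makes its range closed; being open as well,
  the range is the whole space.
\<close>

lemma commuting_selfadjoint_quintic_eq:
  fixes L R :: "'a::real_inner \<Rightarrow> 'a"
  assumes "linear L" "linear R"
    and comm: "\<And>z. L (R z) = R (L z)"
    and symL: "\<And>u v. L u \<bullet> v = u \<bullet> L v"
    and symR: "\<And>u v. R u \<bullet> v = u \<bullet> R v"
    and eq: "15 *\<^sub>R L x - 10 *\<^sub>R L (L (L x)) + 3 *\<^sub>R L (L (L (L (L x)))) =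
             15 *\<^sub>R R x - 10 *\<^sub>R R (R (R x)) + 3 *\<^sub>R R (R (R (R (R x))))"
  shows "L x = R x"
proof -
  define C where "C z = L z + R z" for z
  define D where "D z = L z - R z" for z
  \<comment> \<open>With \<open>C\<close>/2 as midpoint and \<open>D\<close> as length of the
    segment, \<open>C\<close>^2/4 + \<open>D\<close>^2/12 is the mean of s^2 over it, so
    \<open>M\<close> is the mean of 1 - s^2. The terms with 15/12 and 1/12 below add up to 15 times
    the variance of s^2.\<close>
  define M where "M z = z - (1/4) *\<^sub>R C (C z) - (1/12) *\<^sub>R D (D z)" for z
  define y where "y = D x"
  note lin = linear_add[OF assms(1)] linear_add[OF assms(2)] linear_diff[OF assms(1)]
    linear_diff[OF assms(2)] linear_scale[OF assms(1)] linear_scale[OF assms(2)]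
  have symC: "C u \<bullet> v = u \<bullet> C v" and symD: "D u \<bullet> v = u \<bullet> D v" for u v
    by (simp_all add: C_def D_def inner_left_distrib inner_right_distrib
        inner_diff_left inner_diff_right symL symR)
  have symM: "M u \<bullet> v = u \<bullet> M v" for u v
    by (simp add: M_def inner_diff_left inner_diff_right symC symD)
  have CD: "C (D z) = D (C z)" for z
    by (simp add: C_def D_def lin comm)
  \<comment> \<open>\<open>p(a) - p(b)\<close> divided by \<open>a - b\<close> is the mean of \<open>p'(s) = 15 (1 - s\<^sup>2)\<^sup>2\<close> over the segment from
    \<open>b\<close> to \<open>a\<close>; integrating in the variable centred at \<open>(a + b) / 2\<close> and completing the square gives
    this sum of squares.\<close>
  have "15 *\<^sub>R M (M y) + (15/12) *\<^sub>R C (C (D (D y))) + (1/12) *\<^sub>R D (D (D (D y))) = 0"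
  proof -
    \<comment> \<open>Pairing with an arbitrary \<open>w\<close> makes this an identity of real
      numbers, within reach of \<open>field_simps\<close>.\<close>
    have "(15 *\<^sub>R M (M y) + (15/12) *\<^sub>R C (C (D (D y))) + (1/12) *\<^sub>R D (D (D (D y)))) \<bullet> w
        = ((15 *\<^sub>R L x - 10 *\<^sub>R L (L (L x)) + 3 *\<^sub>R L (L (L (L (L x))))) -
          (15 *\<^sub>R R x - 10 *\<^sub>R R (R (R x)) + 3 *\<^sub>R R (R (R (R (R x)))))) \<bullet> w" for w
      by (simp add: y_def M_def C_def D_def lin comm inner_left_distrib inner_diff_left field_simps)
    then show ?thesis
      using eq by (metis diff_self inner_eq_zero_iff inner_zero_left)
  qed
  then have "(15 *\<^sub>R M (M y) + (15/12) *\<^sub>R C (C (D (D y))) + (1/12) *\<^sub>R D (D (D (D y)))) \<bullet> y = 0"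
    by simp
  moreover have "M (M y) \<bullet> y = M y \<bullet> M y" by (rule symM)
  moreover have "C (C (D (D y))) \<bullet> y = C (D y) \<bullet> C (D y)"
    by (simp add: symC symD CD)
  moreover have "D (D (D (D y))) \<bullet> y = D (D y) \<bullet> D (D y)"
    by (simp add: symD)
  ultimately have "15 * (M y \<bullet> M y) + (15/12) * (C (D y) \<bullet> C (D y)) + (1/12) * (D (D y) \<bullet> D (D y)) = 0"
    by (simp add: inner_left_distrib)
  then have "D (D y) \<bullet> D (D y) = 0"
    using inner_ge_zero[of "M y"] inner_ge_zero[of "C (D y)"] inner_ge_zero[of "D (D y)"] by linarith
  then have "D (D y) = 0" by simp
  \<comment> \<open>A self-adjoint operator and its square have the same kernel; this strips off the
    factors of \<open>D\<close> one at a time.\<close>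
  then have "D y \<bullet> D y = 0" using symD[of "D y" y] by simp
  then have "D y = 0" by simp
  then have "y \<bullet> y = 0" using symD[of y x] by (simp add: y_def)
  then show ?thesis by (simp add: y_def D_def)
qed

lemma inner_matrix_mult_left:
  fixes A :: "real ^ 'm ^ 'n" and B :: "real ^ 'p ^ 'm" and C :: "real ^ 'p ^ 'n"
  shows "(A ** B) \<bullet> C = B \<bullet> (transpose A ** C)"
proof -
  have "(A ** B) \<bullet> C = (\<Sum>i\<in>UNIV. \<Sum>j\<in>UNIV. \<Sum>k\<in>UNIV. A$i$k * B$k$j * C$i$j)"
    by (simp add: inner_vec_def matrix_matrix_mult_def sum_distrib_right)
  also have "\<dots> = (\<Sum>i\<in>UNIV. \<Sum>k\<in>UNIV. \<Sum>j\<in>UNIV. A$i$k * B$k$j * C$i$j)"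
    by (intro sum.cong refl sum.swap)
  also have "\<dots> = (\<Sum>k\<in>UNIV. \<Sum>i\<in>UNIV. \<Sum>j\<in>UNIV. A$i$k * B$k$j * C$i$j)"
    by (rule sum.swap)
  also have "\<dots> = (\<Sum>k\<in>UNIV. \<Sum>j\<in>UNIV. \<Sum>i\<in>UNIV. A$i$k * B$k$j * C$i$j)"
    by (intro sum.cong refl sum.swap)
  also have "\<dots> = B \<bullet> (transpose A ** C)"
    by (simp add: inner_vec_def matrix_matrix_mult_def transpose_def sum_distrib_left mult_ac)
  finally show ?thesis .
qed

lemma inner_transpose:
  fixes A B :: "real ^ 'm ^ 'n"
  shows "transpose A \<bullet> transpose B = A \<bullet> B"
  unfolding inner_vec_def transpose_def by (simp, rule sum.swap)

lemma inner_matrix_mult_right: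
  fixes A :: "real ^ 'p ^ 'm" and B :: "real ^ 'm ^ 'n" and C :: "real ^ 'p ^ 'n"
  shows "(B ** A) \<bullet> C = B \<bullet> (C ** transpose A)"
proof -
  have "(B ** A) \<bullet> C = (transpose A ** transpose B) \<bullet> transpose C"
    by (metis inner_transpose matrix_transpose_mul)
  also have "\<dots> = transpose B \<bullet> (A ** transpose C)"
    by (simp add: inner_matrix_mult_left)
  also have "\<dots> = B \<bullet> (C ** transpose A)"
    by (metis inner_transpose matrix_transpose_mul transpose_transpose)
  finally show ?thesis .
qed

lemma matrix_mult_add_left: "(A + B) ** C = A ** C + B ** C" for A :: "real ^ 'm ^ 'n"
  by (simp add: vec_eq_iff matrix_matrix_mult_def sum.distrib distrib_right)

lemma matrix_mult_diff_right: "A ** (B - C) = A ** B - A ** C" for A :: "real ^ 'm ^ 'n"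
  by (simp add: vec_eq_iff matrix_matrix_mult_def sum_subtractf right_diff_distrib)

text \<open>Nesting the products to the right matches the form that iterating
  \<open>dilation_left\<close> produces.\<close>

lemma \<A>_expand:
  "8 *\<^sub>R \<A> X = 15 *\<^sub>R X - 10 *\<^sub>R (X ** (transpose X ** X))
     + 3 *\<^sub>R (X ** (transpose X ** (X ** (transpose X ** X))))"
  by (simp add: \<A>_def matrix_add_ldistrib matrix_mult_diff_right matrix_scalar_ac scalar_matrix_assoc[symmetric]
      matrix_mul_assoc)

text \<open>The tuple \<open>(P, B, C, Q)\<close> stands for the block matrix with rows \<open>(P, B)\<close> and \<open>(C, Q)\<close>.\<close>

definition dilation_left :: "real^'p^'n \<Rightarrow>
    (real^'n^'n) \<times> (real^'p^'n) \<times> (real^'n^'p) \<times> (real^'p^'p) \<Rightarrow>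
    (real^'n^'n) \<times> (real^'p^'n) \<times> (real^'n^'p) \<times> (real^'p^'p)" where
  "dilation_left X = (\<lambda>(P, B, C, Q). (X ** C, X ** Q, transpose X ** P, transpose X ** B))"

definition dilation_right :: "real^'p^'n \<Rightarrow>
    (real^'n^'n) \<times> (real^'p^'n) \<times> (real^'n^'p) \<times> (real^'p^'p) \<Rightarrow>
    (real^'n^'n) \<times> (real^'p^'n) \<times> (real^'n^'p) \<times> (real^'p^'p)" where
  "dilation_right Y = (\<lambda>(P, B, C, Q). (B ** transpose Y, P ** Y, Q ** transpose Y, C ** Y))"

lemma linear_dilation_left: "linear (dilation_left X)"
  by (rule linearI)
    (auto simp: dilation_left_def matrix_add_ldistrib matrix_scalar_ac scalar_matrix_assoc[symmetric])

lemma linear_dilation_right: "linear (dilation_right Y)"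
  by (rule linearI)
    (auto simp: dilation_right_def matrix_mult_add_left scalar_matrix_assoc[symmetric])

lemma dilation_left_selfadjoint: "dilation_left X u \<bullet> v = u \<bullet> dilation_left X v"
  by (cases u; cases v) (auto simp: dilation_left_def inner_matrix_mult_left)

lemma dilation_right_selfadjoint: "dilation_right Y u \<bullet> v = u \<bullet> dilation_right Y v"
  by (cases u; cases v) (auto simp: dilation_right_def inner_matrix_mult_right)

lemma dilation_commute:
  "dilation_left X (dilation_right Y z) = dilation_right Y (dilation_left X z)"
  by (cases z) (auto simp: dilation_left_def dilation_right_def matrix_mul_assoc)

lemma inj_\<A>: "inj \<A>"
proof (rule injI)
  fix X Y :: "real^'p^'n"
  assume "\<A> X = \<A> Y"
  then have eq: "8 *\<^sub>R \<A> X = 8 *\<^sub>R \<A> Y"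
    and eqT: "transpose (8 *\<^sub>R \<A> X) = transpose (8 *\<^sub>R \<A> Y)" by simp_all
  have transpose_\<A>: "transpose (8 *\<^sub>R \<A> Z) = 15 *\<^sub>R transpose Z - 10 *\<^sub>R (transpose Z ** (Z ** transpose Z))
     + 3 *\<^sub>R (transpose Z ** (Z ** (transpose Z ** (Z ** transpose Z))))" for Z :: "real^'p^'n"
  proof -
    have tr: "transpose (a *\<^sub>R U - b *\<^sub>R V + c *\<^sub>R W) =
        a *\<^sub>R transpose U - b *\<^sub>R transpose V + c *\<^sub>R transpose W" for a b c and U V W :: "real^'p^'n"
      by (simp add: transpose_def vec_eq_iff)
    show ?thesis
      unfolding \<A>_expand tr by (simp add: matrix_transpose_mul matrix_mul_assoc)
  qed
  \<comment> \<open>At the identity, iterating the two operators yields the powers of the block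
    matrices of \<open>X\<close> and \<open>Y\<close>. Odd powers have zero diagonal blocks, so only
    \<open>\<A>\<close> and its transpose remain to be compared.\<close>
  let ?I = "(mat 1, 0, 0, mat 1) :: (real^'n^'n) \<times> (real^'p^'n) \<times> (real^'n^'p) \<times> (real^'p^'p)"
  have "dilation_left X ?I = dilation_right Y ?I"
  proof (rule commuting_selfadjoint_quintic_eq[OF linear_dilation_left linear_dilation_right
        dilation_commute dilation_left_selfadjoint dilation_right_selfadjoint])
    let ?L = "dilation_left X" and ?R = "dilation_right Y"
    have "15 *\<^sub>R ?L ?I - 10 *\<^sub>R ?L (?L (?L ?I)) + 3 *\<^sub>R ?L (?L (?L (?L (?L ?I))))
        = (0, 8 *\<^sub>R \<A> X, transpose (8 *\<^sub>R \<A> X), 0)"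
      unfolding transpose_\<A> unfolding \<A>_expand by (simp add: dilation_left_def zero_prod_def)
    moreover have "15 *\<^sub>R ?R ?I - 10 *\<^sub>R ?R (?R (?R ?I)) + 3 *\<^sub>R ?R (?R (?R (?R (?R ?I))))
        = (0, 8 *\<^sub>R \<A> Y, transpose (8 *\<^sub>R \<A> Y), 0)"
      unfolding transpose_\<A> unfolding \<A>_expand
      by (simp add: dilation_right_def matrix_mul_assoc zero_prod_def)
    ultimately show "15 *\<^sub>R ?L ?I - 10 *\<^sub>R ?L (?L (?L ?I)) + 3 *\<^sub>R ?L (?L (?L (?L (?L ?I)))) =
        15 *\<^sub>R ?R ?I - 10 *\<^sub>R ?R (?R (?R ?I)) + 3 *\<^sub>R ?R (?R (?R (?R (?R ?I))))"
      using eq eqT by simp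
  qed
  then show "X = Y" by (simp add: dilation_left_def dilation_right_def)
qed

lemma continuous_on_matrix_mult [continuous_intros]:
  fixes f :: "'a::topological_space \<Rightarrow> real^'m^'n" and g :: "'a \<Rightarrow> real^'p^'m"
  assumes "continuous_on S f" "continuous_on S g"
  shows "continuous_on S (\<lambda>x. f x ** g x)"
  unfolding matrix_matrix_mult_def by (intro continuous_intros assms)

lemma continuous_on_transpose [continuous_intros]:
  fixes f :: "'a::topological_space \<Rightarrow> real^'m^'n"
  assumes "continuous_on S f"
  shows "continuous_on S (\<lambda>x. transpose (f x))"
  unfolding transpose_def by (intro continuous_intros assms)

lemma continuous_on_\<A>: "continuous_on S \<A>"
  unfolding \<A>_def by (intro continuous_intros)

text \<open>Completing the square, 15 - 10 t + 3 t^2 = 3 (t - 5/3)^2 + 20/3 with t in the role of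
  \<open>transpose X ** X\<close>; dividing 20/3 by 8 gives 5/6.\<close>

lemma norm_\<A>_ge: "5/6 * norm X \<le> norm (\<A> X)"
proof -
  define Z where "Z = X ** (transpose X ** X)"
  have Z1: "(X ** (transpose X ** Z)) \<bullet> X = Z \<bullet> Z"
    using inner_matrix_mult_right[of Z "transpose X ** X" X]
    unfolding Z_def by (simp add: matrix_mul_assoc matrix_transpose_mul)
  have "8 * (\<A> X \<bullet> X) = (8 *\<^sub>R \<A> X) \<bullet> X" by simp
  also have "\<dots> = 15 * (X \<bullet> X) - 10 * (Z \<bullet> X) + 3 * (Z \<bullet> Z)"
    unfolding \<A>_expand by (simp add: inner_left_distrib inner_diff_left Z1 flip: Z_def)
  also have "\<dots> = 20/3 * (X \<bullet> X) + 3 * ((Z - (5/3) *\<^sub>R X) \<bullet> (Z - (5/3) *\<^sub>R X))"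
    by (simp add: inner_diff_left inner_diff_right inner_commute algebra_simps)
  finally have "5/6 * (X \<bullet> X) \<le> \<A> X \<bullet> X"
    using inner_ge_zero[of "Z - (5/3) *\<^sub>R X"] by linarith
  also have "\<dots> \<le> norm (\<A> X) * norm X" by (rule norm_cauchy_schwarz)
  finally have "(5/6 * norm X) * norm X \<le> norm (\<A> X) * norm X"
    by (simp add: dot_square_norm power2_eq_square)
  then show ?thesis
    by (cases "X = 0") auto
qed

text \<open>Preimages of a convergent sequence stay bounded by \<open>norm_\<A>_ge\<close>, so a
  subsequence converges, and continuity sends its limit to \<open>l\<close>.\<close>

lemma closed_range_\<A>: "closed (range (\<A> :: real^'p^'n \<Rightarrow> real^'p^'n))"
proof (unfold closed_sequential_limits, intro allI impI, elim conjE)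
  fix f :: "nat \<Rightarrow> real^'p^'n" and l
  assume "\<forall>n. f n \<in> range \<A>" and lim: "f \<longlonglongrightarrow> l"
  then obtain x where x: "\<And>n. f n = \<A> (x n)"
    unfolding image_iff by metis
  obtain K where K: "\<And>n. norm (f n) \<le> K"
    using convergent_imp_Bseq[OF convergentI[OF lim]] by (auto simp: Bseq_def)
  have "x n \<in> cball 0 (6/5 * K)" for n
    using norm_\<A>_ge[of "x n"] K[of n] x[of n] by simp
  then obtain a r where a: "strict_mono r" "(x \<circ> r) \<longlonglongrightarrow> a"
    using compact_cball[of 0 "6/5 * K"] unfolding compact_def by blast
  have "(\<lambda>n. \<A> ((x \<circ> r) n)) \<longlonglongrightarrow> \<A> a"
    using continuous_on_tendsto_compose[OF continuous_on_\<A>[of UNIV] a(2)] by simp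
  moreover have "(\<lambda>n. \<A> ((x \<circ> r) n)) \<longlonglongrightarrow> l"
    using LIMSEQ_subseq_LIMSEQ[OF lim a(1)] by (simp add: o_def x)
  ultimately show "l \<in> range \<A>"
    using LIMSEQ_unique by blast
qed

lemma open_image_\<A>: "open S \<Longrightarrow> open (\<A> ` S)"
  by (rule invariance_of_domain[OF continuous_on_\<A> _ inj_on_subset[OF inj_\<A>]]) auto

lemma surj_\<A>: "range \<A> = UNIV"
  using clopen[of "range \<A>"] closed_range_\<A> open_image_\<A>[OF open_UNIV] by auto

theorem lemma3p5:
  shows "(\<exists>g. homeomorphism UNIV UNIV (\<A> :: real ^ 'p ^ 'n \<Rightarrow> real ^ 'p ^ 'n) g) \<and>
    (\<forall>X :: real ^ 'p ^ 'n. \<forall>\<epsilon> > 0. \<exists>\<delta> > 0. \<B> (\<A> X) \<delta> \<subseteq> \<A> ` \<B> X \<epsilon>)"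
proof (intro conjI allI impI)
  show "\<exists>g. homeomorphism UNIV UNIV (\<A> :: real ^ 'p ^ 'n \<Rightarrow> real ^ 'p ^ 'n) g"
    using invariance_of_domain_homeomorphism[OF open_UNIV continuous_on_\<A> order_refl inj_\<A>]
    by (metis surj_\<A>)
next
  fix X :: "real ^ 'p ^ 'n" and \<epsilon> :: real
  assume "\<epsilon> > 0"
  \<comment> \<open>The image of the open ball is open and contains \<open>\<A> X\<close>, so a
    closed ball around that point fits inside.\<close>
  then obtain \<delta> where "\<delta> > 0" "cball (\<A> X) \<delta> \<subseteq> \<A> ` ball X \<epsilon>"
    using open_image_\<A>[OF open_ball[of X \<epsilon>]] by (meson centre_in_ball imageI open_contains_cball)
  then show "\<exists>\<delta> > 0. \<B> (\<A> X) \<delta> \<subseteq> \<A> ` \<B> X \<epsilon>"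
    unfolding \<B>_eq_cball by (meson ball_subset_cball image_mono order_trans)
qed

end
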